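(* Let $P$ be a finitely additive prevision, let $\mathcal{D}$ be a set of random variables on $\Omega$, let $\pi=\{H_j\}_{j=1}^\infty$ be a denumerable partition of $\Omega$ into nonempty events, and let $P(\cdot\mid H_j)$ be the corresponding conditional previsions associated with $P$. Let $\mathcal{C}$ be a collection of strictly proper scoring rules of integral form (as defined in the context) that satisfies the uniform similarity condition. Assume that the conditional previsions $P(\cdot\mid H_j)$ are nonconglomerable in $\pi$ with respect to $\mathcal{D}$. Then there exists a random variable $X\in\mathcal{D}$, with $p_X=P(X)$ and $p_j=P(X\mid H_j)$ for all $j$, such that both of the following hold. (2.1) For some real numbers $\alpha_0,\alpha_1,\alpha_2,\dots$, the countable sum of individually fair options $$\alpha_0(X-p_X)+\sum_{j=1}^\infty\alpha_jH_j(X-p_j)$$ (regarded as a loss) is uniformly strictly dominated by abstaining; that is, there is $\varepsilon>0$ such that $\alpha_0(X(\omega)-p_X)+\sum_{j=1}^\infty\alpha_jH_j(\omega)(X(\omega)-p_j)>\varepsilon$ for all $\omega\in\Omega$. (2.2) Whenever the forecast for $X$ is scored by $g_0\in\mathcal{C}$ and, for $j=1,2,\dots$, the conditional forecast for $X$ given $H_j$ is scored by $g_j\in\mathcal{C}$, the sum of the scores is uniformly strictly dominated by the sum of scores from a rival set of forecasts; that is, there exist real numbers $q_X,q_1,q_2,\dots$ and $\varepsilon>0$ such that for all $\omega\in\Omega$ $$g_0(X(\omega),p_X)+\sum_{j=1}^\infty H_j(\omega)g_j(X(\omega),p_j)\;>\;g_0(X(\omega),q_X)+\sum_{j=1}^\infty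 H_j(\omega)g_j(X(\omega),q_j)+\varepsilon .$$
   Context: $\Omega$ is a nonempty set; a random variable is an arbitrary function $\Omega\to\mathbb{R}$; events (subsets of $\Omega$) are identified with their indicator functions, so $H_j(\omega)=1$ if $\omega\in H_j$ and $0$ otherwise. Previsions: a collection of real numbers $\{P(X_i\mid B_i): i\in I\}$ ($X_i$ random variables, $B_i$ nonempty events, $P(X)=P(X\mid\Omega)$) is coherent$_1$ if for every finite $\{i_1,\dots,i_n\}\subseteq I$ and all real $\alpha_1,\dots,\alpha_n$ there is no $\varepsilon>0$ such that $\sum_{k=1}^n\alpha_k B_{i_k}(\omega)[X_{i_k}(\omega)-P(X_{i_k}\mid B_{i_k})]\ge\varepsilon$ for all $\omega$. A finitely additive prevision $P$ together with its associated conditional previsions $P(\cdot\mid H_j)$ means a coherent$_1$ collection of real values $P(X)$ and $P(X\mid H_j)$, $X\in\mathcal{D}$, $j\ge1$. Nonconglomerable: the previsions are nonconglomerable in $\pi$ with respect to $\mathcal{D}$ if it is not the case that $\inf_j P(X\mid H_j)\le P(X)\le\sup_jP(X\mid H_j)$ for every $X\in\mathcal{D}$. Scoring rules of integral form: $g:\mathbb{R}\times\mathbb{R}\to[0,\infty)$ is of integral form if there is a measure $\lambda$ on $\mathbb{R}$, mutually absolutely continuous with Lebesgue measure and finite on every bounded interval, such that $$g(x,q)=\int_x^q (v-x)\,d\lambda(v)\ \text{ if } x\le q,\qquad g(x,q)=\int_q^x (x-v)\,d\lambda(v)\ \text{ if } x>q .$$ (Such rules are strictly proper, i.e. expected score is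 uniquely minimized by taking the forecast equal to the mean.) Uniform similarity condition: a collection $\mathcal{C}=\{g_i:i\in I\}$ of scoring rules of integral form with corresponding measures $\{\lambda_i:i\in I\}$ satisfies it if for every $\varepsilon>0$ and every $i\in I$ there exists $\gamma_{i,\varepsilon}>0$ such that for all $j\in I$ and all real $a<b$, $\lambda_i((a,b))\ge\varepsilon$ implies $\lambda_j((a,b))\ge\gamma_{i,\varepsilon}$. *)

theory Defs
  imports "HOL-Analysis.Analysis"
begin

text \<open>
  The nonempty set \<open>\<Omega>\<close> is the type \<open>'w\<close>. A random variable is an arbitrary
  function \<open>'w \<Rightarrow> real\<close>, an event is a set over \<open>'w\<close>. \<open>P X B\<close> stands for the conditional
  prevision of \<open>X\<close> given \<open>B\<close>, and \<open>P X UNIV\<close> for the unconditional prevision of \<open>X\<close>.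
\<close>

text \<open>
  The collection of previsions is indexed by the set \<open>K\<close> of the pairs \<open>(X, B)\<close> it covers; values
  of \<open>P\<close> outside \<open>K\<close> are irrelevant.
\<close>

definition coherent1 ::
  "(('w \<Rightarrow> real) \<times> 'w set) set \<Rightarrow> (('w \<Rightarrow> real) \<Rightarrow> 'w set \<Rightarrow> real) \<Rightarrow> bool" where
  "coherent1 K P \<longleftrightarrow>
     (\<forall>(X, B) \<in> K. B \<noteq> {}) \<and>
     (\<forall>F \<alpha>. finite F \<and> F \<subseteq> K \<longrightarrow>
        \<not> (\<exists>\<epsilon>>0. \<forall>\<omega>.
             (\<Sum>(X, B)\<in>F. \<alpha> (X, B) * indicat_real B \<omega> * (X \<omega> - P X B)) \<ge> \<epsilon>))"

text \<open>
  The previsions given the members of a partition may be unbounded, so infimum and supremum are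
  taken in the extended reals.
\<close>

definition nonconglomerable ::
  "(('w \<Rightarrow> real) \<Rightarrow> 'w set \<Rightarrow> real) \<Rightarrow> (nat \<Rightarrow> 'w set) \<Rightarrow> ('w \<Rightarrow> real) set \<Rightarrow> bool" where
  "nonconglomerable P H D \<longleftrightarrow>
     \<not> (\<forall>X\<in>D. (INF j. ereal (P X (H j))) \<le> ereal (P X UNIV) \<and>
               ereal (P X UNIV) \<le> (SUP j. ereal (P X (H j))))"

text \<open>
  The first argument of a scoring rule is the outcome, the second one is the forecast. Since
  \<open>\<lambda>\<close> has no atoms, it does not matter whether the end points of the intervals of integration are
  included. Rules of integral form are strictly proper, so strict propriety is not a separate
  condition.
\<close>

definition integral_form :: "real measure \<Rightarrow> (real \<Rightarrow> real \<Rightarrow> real) \<Rightarrow> bool" where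
  "integral_form lam g \<longleftrightarrow>
     sets lam = sets borel \<and>
     absolutely_continuous lborel lam \<and> absolutely_continuous lam lborel \<and>
     (\<forall>a b. emeasure lam {a..b} < \<infinity>) \<and>
     (\<forall>x q. 0 \<le> g x q) \<and>
     (\<forall>x q. x \<le> q \<longrightarrow> g x q = (LINT v:{x..q}|lam. v - x)) \<and>
     (\<forall>x q. x > q \<longrightarrow> g x q = (LINT v:{q..x}|lam. x - v))"

text \<open>
  Used only for measures that are finite on bounded intervals, where the real-valued
  \<open>measure\<close> loses no information.
\<close>

definition uniformly_similar :: "'i set \<Rightarrow> ('i \<Rightarrow> real measure) \<Rightarrow> bool" where
  "uniformly_similar I lam \<longleftrightarrow>
     (\<forall>\<epsilon>>0. \<forall>i\<in>I. \<exists>\<gamma>>0. \<forall>j\<in>I. \<forall>a b. a < b \<longrightarrow>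
        measure (lam i) {a<..<b} \<ge> \<epsilon> \<longrightarrow> measure (lam j) {a<..<b} \<ge> \<gamma>)"

end

theory Submission
  imports Defs "HOL-Probability.Distribution_Functions"
begin

text \<open>
  Failure of conglomerability for \<open>X\<close> puts a gap between the prevision \<open>p\<^sub>X\<close> and all conditional
  previsions \<open>p\<^sub>j\<close>: some real \<open>c\<close> satisfies \<open>p\<^sub>X < c \<le> p\<^sub>j\<close> for all \<open>j\<close>, or \<open>p\<^sub>j \<le> c < p\<^sub>X\<close> for all \<open>j\<close>.
  On \<open>H\<^sub>j\<close> the options \<open>X - p\<^sub>X\<close> and \<open>X - p\<^sub>j\<close> differ by \<open>p\<^sub>j - p\<^sub>X\<close> whatever the value of \<open>X\<close>, so
  taking one with coefficient \<open>1\<close> and all the others with coefficient \<open>-1\<close> (or the opposite) loses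
  at least the size of the gap everywhere.

  For scores the same cancellation of \<open>X\<close> has to be arranged. A rule of integral form satisfies
  \<open>g(x,a) - g(x,b) = \<integral>\<^bsub>[a,b]\<^esub> (x - v) d\<lambda>(v)\<close> for all \<open>x\<close>, wherever \<open>x\<close> lies relative to \<open>a\<close> and \<open>b\<close>
  (\<open>score_difference\<close>). This is affine in \<open>x\<close> with slope \<open>\<lambda>[a,b]\<close>. Hence, if the lower forecast moves up
  and the higher forecast moves down, over intervals of the same mass \<open>m\<close> under their respective
  measures, then \<open>x\<close> drops out of the total improvement, which is at least \<open>m\<close> times the distance
  that remains between the two forecasts (\<open>score_exchange\<close>).

  Two things keep this improvement bounded away from \<open>0\<close>. The forecasts move only so far that a fixed
  part of the gap remains between them. And one mass \<open>m > 0\<close> serves all \<open>j\<close>: the \<open>p\<^sub>j\<close> may be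
  unbounded, so an interval of fixed length next to \<open>p\<^sub>j\<close> can have mass tending to \<open>0\<close>, but \<open>p\<^sub>j\<close> may
  move as far as into the gap, over an interval that includes a fixed part of the gap, whose mass is bounded below over the
  whole collection by uniform similarity (\<open>common_mass\<close>). As the measures have no atoms, the
  intermediate value theorem gives intervals of mass exactly \<open>m\<close>
  (\<open>initial_interval_of_mass\<close>, \<open>final_interval_of_mass\<close>).
\<close>

section \<open>Measures equivalent to Lebesgue measure and finite on bounded intervals\<close>

locale integral_form_measure =
  fixes M :: "real measure"
  assumes sets_M: "sets M = sets borel"
    and lborel_ac: "absolutely_continuous lborel M"
    and ac_lborel: "absolutely_continuous M lborel"
    and finite_Icc: "emeasure M {a..b} < \<infinity>"
begin

lemma sets_borel [measurable]: "A \<in> sets borel \<Longrightarrow> A \<in> sets M"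
  by (simp add: sets_M)

lemma no_atoms: "{x} \<in> null_sets M"
proof -
  have "{x} \<in> null_sets lborel" by auto
  then show ?thesis using lborel_ac by (auto simp: absolutely_continuous_def)
qed

lemma fmeasurable_Icc [simp]: "{a..b} \<in> fmeasurable M"
  using finite_Icc[of a b] by (intro fmeasurableI) auto

lemma measure_interval_pos:
  assumes "a < b"
  shows "0 < measure M {a<..<b}"
proof -
  have "{a<..<b} \<notin> null_sets M"
  proof
    assume "{a<..<b} \<in> null_sets M"
    then have "{a<..<b} \<in> null_sets lborel"
      using ac_lborel by (auto simp: absolutely_continuous_def)
    then show False using assms by (auto simp: null_sets_def)
  qed
  moreover have "{a<..<b} \<in> fmeasurable M"
    by (rule fmeasurableI2[OF fmeasurable_Icc[of a b]]) auto
  ultimately show ?thesis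
    by (metis fmeasurableD null_setsI emeasure_eq_measure2
        ennreal_0 less_eq_real_def measure_nonneg)
qed

lemma measure_Ioo_le_Icc: "a \<le> c \<Longrightarrow> d \<le> b \<Longrightarrow> measure M {c<..<d} \<le> measure M {a..b}"
  by (rule measure_mono_fmeasurable) auto

lemma Icc_split_AE: "AE x in M. \<not> (x \<in> {a..b} \<and> x \<in> {b..c})"
  by (rule AE_I'[OF no_atoms[of b]]) auto

lemma measure_Icc_split:
  assumes "a \<le> b" "b \<le> c"
  shows "measure M {a..c} = measure M {a..b} + measure M {b..c}"
proof -
  have "{a..b} \<inter> {b..c} = {b}" using assms by auto
  then have "measure M ({a..b} \<inter> {b..c}) = 0"
    using no_atoms[of b] by (simp add: measure_eq_0_null_sets)
  then show ?thesis
    using measure_Un3[of "{a..b}" M "{b..c}"] assms by (simp add: ivl_disj_un_two_touch)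
qed

text \<open>
  The restriction of the measure to \<open>[a,b]\<close> is finite, and its distribution function, being
  continuous in the absence of atoms, takes every value between \<open>0\<close> and the mass of \<open>[a,b]\<close>.
\<close>

lemma initial_interval_of_mass:
  assumes "a \<le> b" "0 \<le> m" "m \<le> measure M {a..b}"
  obtains c where "a \<le> c" "c \<le> b" "measure M {a..c} = m"
proof -
  define N where "N = density M (indicator {a..b})"
  have meas: "measure N A = measure M ({a..b} \<inter> A)" if "A \<in> sets borel" for A
    unfolding N_def by (rule measure_restricted) (use that in auto)
  have "space M = UNIV" using sets_eq_imp_space_eq[OF sets_M] by simp
  then have "finite_measure N"
    unfolding N_def using finite_Icc[of a b]
    by (intro finite_measureI) (auto simp: emeasure_restricted)
  then interpret N: finite_borel_measure N
    by (intro finite_borel_measure.intro finite_borel_measure_axioms.intro)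
      (simp_all add: N_def sets_M)
  have eq: "cdf N c = measure M {a..c}" if "c \<le> b" for c
    using that unfolding cdf_def by (subst meas) (auto intro!: arg_cong[where f = "measure M"])
  have "measure N {x} = 0" for x
    unfolding meas[OF borel_singleton[OF sets.empty_sets]]
    by (intro measure_eq_0_null_sets null_sets_subset[OF no_atoms[of x]]) auto
  then have "\<forall>x. a \<le> x \<and> x \<le> b \<longrightarrow> isCont (cdf N) x" by (simp add: N.isCont_cdf)
  moreover have "cdf N a \<le> m"
    using eq[OF assms(1)] assms(2) no_atoms[of a] by (simp add: measure_eq_0_null_sets)
  moreover have "m \<le> cdf N b" using eq[of b] assms(3) by simp
  ultimately obtain c where "a \<le> c" "c \<le> b" "cdf N c = m" using IVT[of "cdf N" a m b] assms(1) by auto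
  then show thesis using that eq by metis
qed

lemma final_interval_of_mass:
  assumes "a \<le> b" "0 \<le> m" "m \<le> measure M {a..b}"
  obtains c where "a \<le> c" "c \<le> b" "measure M {c..b} = m"
proof -
  obtain c where c: "a \<le> c" "c \<le> b" "measure M {a..c} = measure M {a..b} - m"
    using initial_interval_of_mass[of a b "measure M {a..b} - m"] assms by auto
  then show thesis using that measure_Icc_split[of a c b] by auto
qed

lemma set_integrable_affine: "set_integrable M {a..b} (\<lambda>v. x - v)"
  unfolding set_integrable_def
proof (rule integrableI_bounded_set_indicator)
  show "(\<lambda>v. x - v) \<in> borel_measurable M" by (simp add: measurable_cong_sets[OF sets_M refl])
  show "AE v in M. v \<in> {a..b} \<longrightarrow> norm (x - v) \<le> \<bar>x\<bar> + \<bar>a\<bar> + \<bar>b\<bar>" by auto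
qed (use finite_Icc in auto)

lemma set_integral_affine_split:
  assumes "a \<le> b" "b \<le> c"
  shows "(LINT v:{a..c}|M. x - v) = (LINT v:{a..b}|M. x - v) + (LINT v:{b..c}|M. x - v)"
  using set_integral_Un_AE[OF Icc_split_AE _ _ set_integrable_affine set_integrable_affine,
      of a b c x] assms
  by (simp add: ivl_disj_un_two_touch)

lemma set_integral_affine_bounds:
  assumes "a \<le> b"
  shows "measure M {a..b} * (x - b) \<le> (LINT v:{a..b}|M. x - v)"
    and "(LINT v:{a..b}|M. x - v) \<le> measure M {a..b} * (x - a)"
proof -
  have fin: "emeasure M {a..b} \<noteq> \<infinity>" using finite_Icc[of a b] by simp
  have const: "(LINT v:{a..b}|M. y) = measure M {a..b} * y" for y :: real
    using set_integral_const[OF _ fin, of y] by simp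
  have int: "set_integrable M {a..b} (\<lambda>v. y)" for y :: real
    unfolding set_integrable_def
    by (rule integrableI_bounded_set_indicator[where B = "\<bar>y\<bar>"]) (use finite_Icc in auto)
  show "measure M {a..b} * (x - b) \<le> (LINT v:{a..b}|M. x - v)"
    unfolding const[symmetric] by (rule set_integral_mono[OF int set_integrable_affine]) auto
  show "(LINT v:{a..b}|M. x - v) \<le> measure M {a..b} * (x - a)"
    unfolding const[symmetric] by (rule set_integral_mono[OF set_integrable_affine int]) auto
qed

end

section \<open>Changing forecasts under scoring rules of integral form\<close>

lemma integral_form_measure_of:
  assumes "integral_form lam g"
  shows "integral_form_measure lam"
  using assms by unfold_locales (auto simp: integral_form_def)

text \<open>
  The integrand in \<open>g(x,q)\<close> is \<open>v - x\<close> or \<open>x - v\<close> according to the side of \<open>q\<close> on which \<open>x\<close> lies, which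
  makes \<open>g(x,q)\<close> the integral of \<open>v - x\<close> from \<open>x\<close> to \<open>q\<close> with the orientation of the interval. Differences
  are therefore given by one formula, also for \<open>x\<close> between the two forecasts.
\<close>

lemma score_difference:
  assumes form: "integral_form lam g" and ab: "a \<le> b"
  shows "g x a - g x b = (LINT v:{a..b}|lam. x - v)"
proof -
  interpret integral_form_measure lam by (rule integral_form_measure_of[OF form])
  have neg: "(LINT v:{c..d}|lam. v - x) = - (LINT v:{c..d}|lam. x - v)" for c d
    using set_integral_uminus[OF set_integrable_affine, of c d x] by simp
  have low: "g x q = - (LINT v:{x..q}|lam. x - v)" if "x \<le> q" for q
    using form that by (simp add: integral_form_def neg)
  have high: "g x q = (LINT v:{q..x}|lam. x - v)" if "x > q" for q
    using form that by (simp add: integral_form_def)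
  consider "x \<le> a" | "a < x" "x \<le> b" | "b < x" by linarith
  then show ?thesis
  proof cases
    case 1
    then show ?thesis using low[of a] low[of b] set_integral_affine_split[of x a b x] ab by simp
  next
    case 2
    then show ?thesis using high[of a] low[of b] set_integral_affine_split[of a x b x] by simp
  next
    case 3
    then show ?thesis using high[of a] high[of b] set_integral_affine_split[of a b x x] ab by simp
  qed
qed

text \<open>
  Since \<open>v \<le> u1\<close> on the first interval and \<open>l2 \<le> v\<close> on the second one, moving the lower forecast from
  \<open>l1\<close> to \<open>u1\<close> gains at least \<open>m (x - u1)\<close>, and moving the higher one from \<open>u2\<close> to \<open>l2\<close> costs at most
  \<open>m (x - l2)\<close>; either of these may have any sign, but \<open>x\<close> cancels.
\<close>

lemma score_exchange:
  assumes "integral_form lam1 g1" "integral_form lam2 g2"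
    and "l1 \<le> u1" "l2 \<le> u2"
    and "measure lam1 {l1..u1} = m" "measure lam2 {l2..u2} = m"
  shows "m * (l2 - u1) \<le> (g1 x l1 + g2 x u2) - (g1 x u1 + g2 x l2)"
proof -
  interpret M1: integral_form_measure lam1 by (rule integral_form_measure_of[OF assms(1)])
  interpret M2: integral_form_measure lam2 by (rule integral_form_measure_of[OF assms(2)])
  have "m * (x - u1) \<le> g1 x l1 - g1 x u1"
    using M1.set_integral_affine_bounds(1)[OF assms(3), of x] assms
    by (simp add: score_difference[OF assms(1)])
  moreover have "g2 x l2 - g2 x u2 \<le> m * (x - l2)"
    using M2.set_integral_affine_bounds(2)[OF assms(4), of x] assms
    by (simp add: score_difference[OF assms(2)])
  ultimately show ?thesis by (simp add: algebra_simps)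
qed

lemma common_mass:
  assumes "uniformly_similar I lam" "i \<in> I" "integral_form_measure (lam i)" "a < b"
  obtains m where "0 < m" "\<And>j. j \<in> I \<Longrightarrow> m \<le> measure (lam j) {a<..<b}"
proof -
  have "0 < measure (lam i) {a<..<b}"
    using assms by (intro integral_form_measure.measure_interval_pos)
  then obtain m where "0 < m"
    "\<forall>j\<in>I. \<forall>c d. c < d \<longrightarrow> measure (lam i) {a<..<b} \<le> measure (lam i) {c<..<d} \<longrightarrow>
        m \<le> measure (lam j) {c<..<d}"
    using assms(1,2) unfolding uniformly_similar_def by metis
  then show thesis using that assms(4) by blast
qed

text \<open>
  The forecast \<open>p0\<close> moves inside \<open>[p0, s]\<close> or \<open>[t, p0]\<close> and each \<open>p j\<close> moves on the other side, where
  \<open>s < t\<close> lie inside the gap, so that at least \<open>t - s\<close> of the gap survives.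
\<close>

lemma rival_forecasts:
  fixes p0 :: real and p :: "nat \<Rightarrow> real"
  assumes rules: "\<forall>i\<in>I. integral_form (lam i) (g i)"
    and similar: "uniformly_similar I lam"
    and idx: "k \<in> I" "\<And>j. k' j \<in> I"
    and gap: "(p0 < c \<and> (\<forall>j. c \<le> p j)) \<or> (c < p0 \<and> (\<forall>j. p j \<le> c))"
  obtains q0 q \<delta> where "0 < \<delta>"
    "\<And>x j. g k x q0 + g (k' j) x (q j) + \<delta> \<le> g k x p0 + g (k' j) x (p j)"
proof -
  define lo where "lo = min p0 c"
  define hi where "hi = max p0 c"
  define s where "s = (2 * lo + hi) / 3"
  define t where "t = (lo + 2 * hi) / 3"
  have "lo < hi" using gap by (auto simp: lo_def hi_def)
  then have st: "lo < s" "s < t" "t < hi" by (auto simp: s_def t_def)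
  note meas = integral_form_measure_of[OF rules[rule_format]]
  obtain m1 where m1: "0 < m1" "\<And>j. j \<in> I \<Longrightarrow> m1 \<le> measure (lam j) {lo<..<s}"
    using common_mass[OF similar idx(1) meas[OF idx(1)] st(1)] by blast
  obtain m2 where m2: "0 < m2" "\<And>j. j \<in> I \<Longrightarrow> m2 \<le> measure (lam j) {t<..<hi}"
    using common_mass[OF similar idx(1) meas[OF idx(1)] st(3)] by blast
  define m where "m = min m1 m2"
  have m: "0 < m" using m1(1) m2(1) by (simp add: m_def)
  have up: "\<exists>u. l \<le> u \<and> u \<le> s \<and> measure (lam i) {l..u} = m" if "i \<in> I" "l \<le> lo" for i l
  proof -
    interpret integral_form_measure "lam i" by (rule meas[OF that(1)])
    have "m \<le> measure (lam i) {l..s}"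
      using m1(2)[OF that(1)] measure_Ioo_le_Icc[OF that(2) order_refl, of s] by (simp add: m_def)
    then show ?thesis
      using initial_interval_of_mass[of l s m] that(2) st m by (metis less_eq_real_def order_trans)
  qed
  have down: "\<exists>l. t \<le> l \<and> l \<le> u \<and> measure (lam i) {l..u} = m" if "i \<in> I" "hi \<le> u" for i u
  proof -
    interpret integral_form_measure "lam i" by (rule meas[OF that(1)])
    have "m \<le> measure (lam i) {t..u}"
      using m2(2)[OF that(1)] measure_Ioo_le_Icc[OF order_refl that(2), of t] by (simp add: m_def)
    then show ?thesis
      using final_interval_of_mass[of t u m] that(2) st m by (metis less_eq_real_def order_trans)
  qed
  have gain: "g i x u + g j x l' + m * (t - s) \<le> g i x l + g j x u'"
    if "i \<in> I" "j \<in> I" "l \<le> u" "u \<le> s" "measure (lam i) {l..u} = m"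
      "t \<le> l'" "l' \<le> u'" "measure (lam j) {l'..u'} = m" for i j l u l' u' x
  proof -
    have "m * (l' - u) \<le> (g i x l + g j x u') - (g i x u + g j x l')"
      using score_exchange[of "lam i" "g i" "lam j" "g j"] rules that by blast
    moreover have "m * (t - s) \<le> m * (l' - u)" using that m by (intro mult_left_mono) auto
    ultimately show ?thesis by linarith
  qed
  have pos: "0 < m * (t - s)" using m st by simp
  from gap show thesis
  proof (elim disjE conjE)
    assume less: "p0 < c" and le: "\<forall>j. c \<le> p j"
    have "p0 \<le> lo" using less by (simp add: lo_def)
    then obtain q0 where "p0 \<le> q0" "q0 \<le> s" "measure (lam k) {p0..q0} = m"
      using up[OF idx(1)] by blast
    moreover have "hi \<le> p j" for j using less spec[OF le, of j] by (simp add: hi_def)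
    then have "\<exists>l. t \<le> l \<and> l \<le> p j \<and> measure (lam (k' j)) {l..p j} = m" for j
      by (intro down idx)
    then obtain q where "\<And>j. t \<le> q j \<and> q j \<le> p j \<and> measure (lam (k' j)) {q j..p j} = m"
      by metis
    ultimately have "g k x q0 + g (k' j) x (q j) + m * (t - s) \<le> g k x p0 + g (k' j) x (p j)" for x j
      by (intro gain idx) auto
    then show thesis by (rule that[OF pos])
  next
    assume less: "c < p0" and le: "\<forall>j. p j \<le> c"
    have "hi \<le> p0" using less by (simp add: hi_def)
    then obtain q0 where "t \<le> q0" "q0 \<le> p0" "measure (lam k) {q0..p0} = m"
      using down[OF idx(1)] by blast
    moreover have "p j \<le> lo" for j using less spec[OF le, of j] by (simp add: lo_def)
    then have "\<exists>u. p j \<le> u \<and> u \<le> s \<and> measure (lam (k' j)) {p j..u} = m" for j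
      by (intro up idx)
    then obtain q where "\<And>j. p j \<le> q j \<and> q j \<le> s \<and> measure (lam (k' j)) {p j..q j} = m"
      by metis
    ultimately have "g (k' j) x (q j) + g k x q0 + m * (t - s) \<le> g (k' j) x (p j) + g k x p0" for x j
      by (intro gain idx) auto
    then show thesis by (intro that[OF pos]) (simp add: add.commute)
  qed
qed

section \<open>Nonconglomerability and dominated sums\<close>

lemma nonconglomerable_gap:
  assumes "nonconglomerable P H D"
  obtains X c where "X \<in> D"
    "(P X UNIV < c \<and> (\<forall>j. c \<le> P X (H j))) \<or> (c < P X UNIV \<and> (\<forall>j. P X (H j) \<le> c))"
proof -
  obtain X where X: "X \<in> D"
    and "ereal (P X UNIV) < (INF j. ereal (P X (H j))) \<or> (SUP j. ereal (P X (H j))) < ereal (P X UNIV)"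
    using assms unfolding nonconglomerable_def by (auto simp: not_le)
  then show thesis
  proof (elim disjE)
    assume "ereal (P X UNIV) < (INF j. ereal (P X (H j)))"
    then obtain c where "ereal (P X UNIV) < ereal c" "ereal c < (INF j. ereal (P X (H j)))"
      using ereal_dense2 by blast
    moreover then have "ereal c \<le> ereal (P X (H j))" for j
      by (meson INF_lower UNIV_I less_imp_le order_trans)
    ultimately show thesis using that[OF X] by auto
  next
    assume "(SUP j. ereal (P X (H j))) < ereal (P X UNIV)"
    then obtain c where "ereal c < ereal (P X UNIV)" "(SUP j. ereal (P X (H j))) < ereal c"
      using ereal_dense2 by blast
    moreover then have "ereal (P X (H j)) \<le> ereal c" for j
      by (meson SUP_upper UNIV_I less_imp_le order_trans)
    ultimately show thesis using that[OF X] by auto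
  qed
qed

lemma suminf_partition:
  fixes f :: "nat \<Rightarrow> real"
  assumes "partition_on UNIV (range H)" "inj H" "\<omega> \<in> H k"
  shows "(\<Sum>j. indicat_real (H j) \<omega> * f j) = f k"
proof -
  have "\<omega> \<notin> H j" if "j \<noteq> k" for j
    using assms that disjointD[OF partition_onD2[OF assms(1)], of "H j" "H k"]
    by (auto dest: injD)
  then show ?thesis
    using suminf_finite[of "{k}" "\<lambda>j. indicat_real (H j) \<omega> * f j"] assms(3) by simp
qed

(* H j, a j, gs j and q j carry the index j + 1 of the usual numbering of the partition from 1.
   For every outcome at most one term of each series is nonzero, so the series converge. *)
theorem theorem2:
  fixes P :: "('w \<Rightarrow> real) \<Rightarrow> 'w set \<Rightarrow> real"
    and D :: "('w \<Rightarrow> real) set"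
    and H :: "nat \<Rightarrow> 'w set"
    and I :: "'i set"
    and g :: "'i \<Rightarrow> real \<Rightarrow> real \<Rightarrow> real"
    and lam :: "'i \<Rightarrow> real measure"
  assumes partition: "partition_on UNIV (range H)" "inj H"
    and coherent: "coherent1 (D \<times> insert UNIV (range H)) P"
    and rules: "\<forall>i\<in>I. integral_form (lam i) (g i)"
    and similar: "uniformly_similar I lam"
    and noncongl: "nonconglomerable P H D"
  shows "\<exists>X\<in>D.
     (\<exists>a0 :: real. \<exists>a :: nat \<Rightarrow> real. \<exists>\<epsilon>>0. \<forall>\<omega>.
        a0 * (X \<omega> - P X UNIV)
          + (\<Sum>j. a j * indicat_real (H j) \<omega> * (X \<omega> - P X (H j))) > \<epsilon>) \<and>
     (\<forall>g0 \<in> g ` I. \<forall>gs :: nat \<Rightarrow> real \<Rightarrow> real \<Rightarrow> real. (\<forall>j. gs j \<in> g ` I) \<longrightarrow>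
        (\<exists>qX :: real. \<exists>q :: nat \<Rightarrow> real. \<exists>\<epsilon>>0. \<forall>\<omega>.
           g0 (X \<omega>) (P X UNIV)
             + (\<Sum>j. indicat_real (H j) \<omega> * gs j (X \<omega>) (P X (H j)))
           > g0 (X \<omega>) qX
             + (\<Sum>j. indicat_real (H j) \<omega> * gs j (X \<omega>) (q j)) + \<epsilon>))"
proof -
  obtain X c where X: "X \<in> D"
    and gap: "(P X UNIV < c \<and> (\<forall>j. c \<le> P X (H j))) \<or> (c < P X UNIV \<and> (\<forall>j. P X (H j) \<le> c))"
    using nonconglomerable_gap[OF noncongl] by blast
  have cover: "\<exists>k. \<omega> \<in> H k" for \<omega>
    using partition_onD1[OF partition(1)] by auto
  note collapse = suminf_partition[OF partition]
  \<comment> \<open>Half the distance, because the sum may equal the full distance at some outcomes.\<close>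
  define d where "d = \<bar>c - P X UNIV\<bar> / 2"
  have "0 < d" using gap by (auto simp: d_def)
  \<comment> \<open>The unconditional option is taken with the sign that makes \<open>\<sigma> (p\<^sub>j - p\<^sub>X)\<close> positive.\<close>
  define \<sigma> :: real where "\<sigma> = (if P X UNIV < c then 1 else - 1)"
  have options: "d < \<sigma> * (X \<omega> - P X UNIV)
      + (\<Sum>j. - \<sigma> * indicat_real (H j) \<omega> * (X \<omega> - P X (H j)))" for \<omega>
  proof -
    obtain k where k: "\<omega> \<in> H k" using cover by blast
    have "(\<Sum>j. - \<sigma> * indicat_real (H j) \<omega> * (X \<omega> - P X (H j))) = - \<sigma> * (X \<omega> - P X (H k))"
      using collapse[OF k, of "\<lambda>j. - \<sigma> * (X \<omega> - P X (H j))"] by (simp add: mult_ac)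
    moreover have "d < \<sigma> * (P X (H k) - P X UNIV)"
      using gap
    proof (elim disjE conjE)
      assume less: "P X UNIV < c" and "\<forall>j. c \<le> P X (H j)"
      then have "c \<le> P X (H k)" by blast
      with less show ?thesis by (simp add: \<sigma>_def d_def)
    next
      assume less: "c < P X UNIV" and "\<forall>j. P X (H j) \<le> c"
      then have "P X (H k) \<le> c" by blast
      with less show ?thesis by (simp add: \<sigma>_def d_def)
    qed
    ultimately show ?thesis by (simp add: algebra_simps)
  qed
  have scores: "\<exists>qX q. \<exists>\<epsilon>>0. \<forall>\<omega>.
      g0 (X \<omega>) (P X UNIV) + (\<Sum>j. indicat_real (H j) \<omega> * gs j (X \<omega>) (P X (H j)))
      > g0 (X \<omega>) qX + (\<Sum>j. indicat_real (H j) \<omega> * gs j (X \<omega>) (q j)) + \<epsilon>"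
    if g0: "g0 \<in> g ` I" and gs: "\<forall>j. gs j \<in> g ` I" for g0 gs
  proof -
    obtain k where k: "k \<in> I" "g0 = g k" using g0 by blast
    obtain k' where k': "\<And>j. k' j \<in> I" "\<And>j. gs j = g (k' j)" using gs unfolding image_iff by metis
    obtain qX q \<delta> where \<delta>: "0 < \<delta>" and
      gain: "\<And>x j. g k x qX + g (k' j) x (q j) + \<delta> \<le> g k x (P X UNIV) + g (k' j) x (P X (H j))"
      using rival_forecasts[OF rules similar k(1), of k' "P X UNIV" c "\<lambda>j. P X (H j)"] k'(1) gap
      by metis
    have "g0 (X \<omega>) (P X UNIV) + (\<Sum>j. indicat_real (H j) \<omega> * gs j (X \<omega>) (P X (H j)))
      > g0 (X \<omega>) qX + (\<Sum>j. indicat_real (H j) \<omega> * gs j (X \<omega>) (q j)) + \<delta> / 2" for \<omega>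
    proof -
      obtain n where n: "\<omega> \<in> H n" using cover by blast
      show ?thesis
        unfolding collapse[OF n] k(2) k'(2) using gain[of "X \<omega>" n] \<delta> by linarith
    qed
    then show ?thesis using half_gt_zero[OF \<delta>] by blast
  qed
  show ?thesis
  proof (intro bexI[OF _ X] conjI ballI allI impI)
    show "\<exists>a0. \<exists>a. \<exists>\<epsilon>>0. \<forall>\<omega>. \<epsilon> < a0 * (X \<omega> - P X UNIV)
        + (\<Sum>j. a j * indicat_real (H j) \<omega> * (X \<omega> - P X (H j)))"
      by (rule exI[of _ \<sigma>], rule exI[of _ "\<lambda>_. - \<sigma>"], rule exI[of _ d])
        (use \<open>0 < d\<close> options in simp)
  qed (rule scores)
qed

end
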